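(* Every Alster topological space is a $D$-space.
   Context: A topological space $X$ is *Alster* if the following holds: whenever $\mathcal{G}$ is a cover of $X$ by $G_\delta$ subsets of $X$ such that every compact subset of $X$ is included in the union of finitely many members of $\mathcal{G}$, then $\mathcal{G}$ has a countable subfamily covering $X$. A topological space $X$ is $D$ (a $D$-space) if for every neighbourhood assignment $\{V_x\}_{x\in X}$ (i.e., each $V_x$ is an open set containing $x$) there is a closed discrete $Y\subseteq X$ such that $\{V_x\}_{x\in Y}$ covers $X$.
   Formalization: The formal theorem assumes in addition that the space is T1; without a separation axiom the claim fails, e.g. the two-point indiscrete space is Alster but, with V_x the whole space, has no suitable closed discrete Y. *)

theory Defs
  imports "HOL-Analysis.Analysis"
begin

definition Alster_space :: "'a topology \<Rightarrow> bool" where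
  "Alster_space X \<longleftrightarrow>
     (\<forall>\<G>. (\<forall>G\<in>\<G>. gdelta_in X G) \<and> \<Union>\<G> = topspace X \<and>
          (\<forall>K. compactin X K \<longrightarrow> (\<exists>\<F>. finite \<F> \<and> \<F> \<subseteq> \<G> \<and> K \<subseteq> \<Union>\<F>))
        \<longrightarrow> (\<exists>\<C>. countable \<C> \<and> \<C> \<subseteq> \<G> \<and> \<Union>\<C> = topspace X))"

definition neighbourhood_assignment :: "'a topology \<Rightarrow> ('a \<Rightarrow> 'a set) \<Rightarrow> bool" where
  "neighbourhood_assignment X V \<longleftrightarrow> (\<forall>x\<in>topspace X. openin X (V x) \<and> x \<in> V x)"

(* No separation axiom is built in. Since points need not be closed in general, this notion is
   only well behaved for T1 spaces: a two-point indiscrete space is an Alster space but not a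
   D-space, as its only nonempty closed subset is not discrete. *)
definition D_space :: "'a topology \<Rightarrow> bool" where
  "D_space X \<longleftrightarrow>
     (\<forall>V. neighbourhood_assignment X V \<longrightarrow>
        (\<exists>Y. closedin X Y \<and> subtopology X Y = discrete_topology Y \<and>
             (\<Union>x\<in>Y. V x) = topspace X))"

end

theory Submission
  imports Defs
begin

text \<open>
  Given a neighbourhood assignment \<open>V\<close>, a finite set \<open>H\<close> of points is enlarged to \<open>nxt H k\<close> by adding
  the first \<open>k\<close> of countably many points outside \<open>\<Union>(V ` H)\<close> whose neighbourhoods cover the rest
  (Alster spaces are Lindelof). Iterating gives a tree of finite sets \<open>st s\<close>, indexed by \<open>s :: nat list\<close>.
  Added points avoid the earlier neighbourhoods, so every branch whose neighbourhoods cover the space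
  has a closed discrete union (this uses T1).
  For a function \<open>g\<close> choosing a successor at each node, the intersection \<open>G g\<close> over all \<open>s\<close> of
  \<open>\<Union>(V ` st (g s # s))\<close> is a \<open>G\<^sub>\<delta>\<close> set, and each compact set lies in some \<open>G g\<close>. The Alster
  property yields \<open>g\<^sub>0, g\<^sub>1, \<dots>\<close> such that the sets \<open>G g\<^sub>n\<close> cover; the branch that follows \<open>g\<^sub>n\<close> at its
  \<open>n\<close>-th node covers the \<open>n\<close>-th of them at that step.
\<close>

text \<open>Open sets are \<G>-delta in the trivial way, and compactness itself supplies the finite
  subfamilies that the Alster property asks for.\<close>

lemma Alster_imp_Lindelof_space:
  assumes "Alster_space X"
  shows "Lindelof_space X"
  unfolding Lindelof_space_def
proof (intro allI impI, elim conjE)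
  fix \<U> assume "\<forall>U\<in>\<U>. openin X U" "\<Union>\<U> = topspace X"
  moreover from this have "\<forall>K. compactin X K \<longrightarrow> (\<exists>\<F>. finite \<F> \<and> \<F> \<subseteq> \<U> \<and> K \<subseteq> \<Union>\<F>)"
    by (simp add: compactin_def)
  ultimately show "\<exists>\<V>. countable \<V> \<and> \<V> \<subseteq> \<U> \<and> \<Union>\<V> = topspace X"
    using assms unfolding Alster_space_def by (simp add: open_imp_gdelta_in)
qed

lemma compactin_subset_incseq_open:
  fixes U :: "nat \<Rightarrow> 'a set"
  assumes "compactin X K" "\<And>n. openin X (U n)" "incseq U" "K \<subseteq> (\<Union>n. U n)"
  shows "\<exists>n. K \<subseteq> U n"
proof -
  have "\<exists>\<F>. finite \<F> \<and> \<F> \<subseteq> range U \<and> K \<subseteq> \<Union>\<F>"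
    using assms unfolding compactin_def by blast
  then obtain N where "finite N" "K \<subseteq> \<Union>(U ` N)"
    by (metis finite_subset_image)
  moreover have "\<Union>(U ` N) \<subseteq> U (Max N)"
    using \<open>incseq U\<close> \<open>finite N\<close> by (force dest: incseqD[OF _ Max_ge])
  ultimately show ?thesis by blast
qed

text \<open>In a T1 space a limit point of \<open>Y\<close> has infinitely many points of
  \<open>Y\<close> in each neighbourhood, so here the derived set is empty.\<close>

lemma locally_finite_imp_closed_discrete:
  assumes "t1_space X" "Y \<subseteq> topspace X"
    and "\<And>x. x \<in> topspace X \<Longrightarrow> \<exists>U. openin X U \<and> x \<in> U \<and> finite (Y \<inter> U)"
  shows "closedin X Y" "subtopology X Y = discrete_topology Y"
proof -
  have "X derived_set_of Y = {}"
    using assms by (force simp: t1_space_derived_set_of_infinite_openin)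
  then show "closedin X Y" "subtopology X Y = discrete_topology Y"
    using assms(2) by (simp_all add: closedin_contains_derived_set subtopology_eq_discrete_topology_eq)
qed

lemma Lindelof_finite_extensions:
  assumes "Lindelof_space X" "neighbourhood_assignment X V" "finite H" "H \<subseteq> topspace X"
  shows "\<exists>E. incseq E \<and> (\<Union>k. \<Union>(V ` E k)) = topspace X \<and>
           (\<forall>k. finite (E k) \<and> H \<subseteq> E k \<and> E k \<subseteq> topspace X \<and> (E k - H) \<inter> \<Union>(V ` H) = {})"
proof -
  let ?W = "\<Union>(V ` H)" and ?R = "topspace X - \<Union>(V ` H)"
  have V: "openin X (V x)" "x \<in> V x" "V x \<subseteq> topspace X" if "x \<in> topspace X" for x
    using assms(2) that openin_subset unfolding neighbourhood_assignment_def by blast+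
  have "openin X ?W" using V assms(4) by blast
  then have "\<forall>U \<in> insert ?W (V ` ?R). openin X U"
    using V by auto
  moreover have "\<Union>(insert ?W (V ` ?R)) = topspace X"
    using V assms(4) by fastforce
  ultimately obtain \<V> where \<V>: "countable \<V>" "\<V> \<subseteq> insert ?W (V ` ?R)" "\<Union>\<V> = topspace X"
    using assms(1) unfolding Lindelof_space_def by meson
  then have "countable (\<V> - {?W})" "\<V> - {?W} \<subseteq> V ` ?R" by auto
  then obtain C where C: "countable C" "C \<subseteq> ?R" "\<V> - {?W} = V ` C"
    by (meson countable_subset_image)
  \<comment> \<open>The new centres \<open>C\<close> are added in the order of an injective
    enumeration, so each \<open>E k\<close> is finite.\<close>
  define E where "E k = H \<union> {x \<in> C. to_nat_on C x \<le> k}" for k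
  have "finite {x \<in> C. to_nat_on C x \<le> k}" for k
    by (rule finite_imageD[OF finite_subset[of _ "{..k}"]])
       (auto intro: inj_on_subset[OF inj_on_to_nat_on[OF C(1)]])
  moreover have "(\<Union>k. E k) = H \<union> C" by (auto simp: E_def)
  then have "(\<Union>k. \<Union>(V ` E k)) = ?W \<union> \<Union>(V ` C)" by blast
  moreover have "?W \<union> \<Union>(V ` C) = ?W \<union> \<Union>\<V>"
    unfolding C(3)[symmetric] by blast
  moreover have "?W \<union> \<Union>\<V> = topspace X"
    using \<V>(3) openin_subset[OF \<open>openin X ?W\<close>] by blast
  ultimately show ?thesis
    using C(2) assms(3,4) by (intro exI[of _ E]) (auto simp: E_def incseq_def)
qed

theorem corollary5:
  fixes X :: "'a topology"
  assumes "t1_space X"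
    and "Alster_space X"
  shows "D_space X"
  unfolding D_space_def
proof (intro allI impI)
  fix V assume nbhd: "neighbourhood_assignment X V"
  have V: "openin X (V x)" "x \<in> V x" if "x \<in> topspace X" for x
    using nbhd that unfolding neighbourhood_assignment_def by blast+
  define ext where "ext H E \<longleftrightarrow> incseq E \<and> (\<Union>k. \<Union>(V ` E k)) = topspace X \<and>
      (\<forall>k. finite (E k) \<and> H \<subseteq> E k \<and> E k \<subseteq> topspace X \<and> (E k - H) \<inter> \<Union>(V ` H) = {})" for H E
  have "\<exists>E. ext H E" if "finite H" "H \<subseteq> topspace X" for H
    unfolding ext_def
    using Lindelof_finite_extensions[OF Alster_imp_Lindelof_space[OF assms(2)] nbhd that] .
  then obtain nxt where "\<And>H. finite H \<Longrightarrow> H \<subseteq> topspace X \<Longrightarrow> ext H (nxt H)"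
    by metis
  note nxt = this[unfolded ext_def]
  define st where "st = rec_list {} (\<lambda>k s H. nxt H k)"
  have st_simps: "st [] = {}" "st (k # s) = nxt (st s) k" for k s
    by (simp_all add: st_def)
  have st: "finite (st s) \<and> st s \<subseteq> topspace X" for s
    by (induction s) (use nxt in \<open>simp_all add: st_simps\<close>)
  define W where "W s = \<Union>(V ` st s)" for s
  have W_open: "openin X (W s)" for s
    using V st unfolding W_def by blast
  \<comment> \<open>All nodes \<open>s\<close> count, not only those that \<open>g\<close> itself
    reaches: the final branch mixes many functions. There are countably many nodes, hence a
    countable intersection.\<close>
  define G where "G g = (\<Inter>s. W (g s # s))" for g
  have "gdelta_in X (G g)" for g
    unfolding G_def by (rule gdelta_in_Inter) (auto intro: open_imp_gdelta_in W_open)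
  moreover have compact_G: "\<exists>g. K \<subseteq> G g" if K: "compactin X K" for K
  proof -
    have "\<exists>k. K \<subseteq> W (k # s)" for s
    proof (rule compactin_subset_incseq_open[OF K W_open])
      show "incseq (\<lambda>k. W (k # s))"
        using nxt[of "st s"] st[of s]
        unfolding incseq_def W_def st_simps by (meson SUP_subset_mono subset_refl)
      show "K \<subseteq> (\<Union>k. W (k # s))"
        using nxt[of "st s"] st[of s] compactin_subset_topspace[OF K] by (simp add: W_def st_simps)
    qed
    then obtain g where "\<And>s. K \<subseteq> W (g s # s)" by metis
    then show ?thesis unfolding G_def by blast
  qed
  moreover have "\<Union>(range G) = topspace X"
  proof
    show "\<Union>(range G) \<subseteq> topspace X"
      using openin_subset[OF W_open] unfolding G_def by blast
    show "topspace X \<subseteq> \<Union>(range G)"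
    proof
      fix x assume "x \<in> topspace X"
      then show "x \<in> \<Union>(range G)" using compact_G[of "{x}"] by auto
    qed
  qed
  moreover have "\<exists>\<F>. finite \<F> \<and> \<F> \<subseteq> range G \<and> K \<subseteq> \<Union>\<F>" if "compactin X K" for K
  proof -
    obtain g where "K \<subseteq> G g" using compact_G[OF \<open>compactin X K\<close>] by blast
    then show ?thesis by (intro exI[of _ "{G g}"]) auto
  qed
  ultimately obtain \<C> where \<C>: "countable \<C>" "\<C> \<subseteq> range G" "\<Union>\<C> = topspace X"
    using assms(2)[unfolded Alster_space_def, rule_format, of "range G"] by auto
  then obtain B where B: "countable B" "\<Union>(G ` B) = topspace X"
    by (metis countable_subset_image)
  \<comment> \<open>Newest choice at the head. If \<open>B\<close> is empty, so is the space, and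
    the arbitrary value of \<open>from_nat_into\<close> does no harm.\<close>
  define p where "p = rec_nat [] (\<lambda>n s. from_nat_into B n s # s)"
  have p_Suc: "p (Suc n) = from_nat_into B n (p n) # p n" for n
    by (simp add: p_def)
  define H where "H n = st (p n)" for n
  have H: "finite (H n)" "H n \<subseteq> topspace X" "H n \<subseteq> H (Suc n)"
      "(H (Suc n) - H n) \<inter> \<Union>(V ` H n) = {}" for n
    using st[of "p n"] nxt[of "st (p n)"] by (simp_all add: H_def p_Suc st_simps)
  have inc: "incseq H" using H(3) by (rule incseq_SucI)
  have cover: "\<exists>n. x \<in> \<Union>(V ` H n)" if "x \<in> topspace X" for x
  proof -
    have "x \<in> \<Union>(G ` B)" using that by (simp only: B(2))
    then obtain g where g: "g \<in> B" "x \<in> G g" by blast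
    then obtain n where "from_nat_into B n = g"
      using from_nat_into_surj[OF B(1)] by blast
    \<comment> \<open>This is membership in \<open>G g\<close> at the node \<open>s = p n\<close>,
      where the branch follows \<open>g\<close>.\<close>
    then have "x \<in> W (p (Suc n))" using g(2) by (auto simp: G_def p_Suc)
    then show ?thesis unfolding W_def H_def by blast
  qed
  define Y where "Y = (\<Union>n. H n)"
  \<comment> \<open>Points added after stage \<open>n\<close> avoid all earlier neighbourhoods, in
    particular those of \<open>H n\<close>; up to stage \<open>n\<close> monotonicity
    suffices.\<close>
  have "H m \<inter> \<Union>(V ` H n) \<subseteq> H n" for m n
  proof (induction m)
    case (Suc m)
    show ?case
    proof (cases "m < n")
      case True
      then show ?thesis using incseqD[OF inc, of "Suc m" n] by auto
    next
      case False
      then have "H n \<subseteq> H m" using incseqD[OF inc] by simp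
      then show ?thesis using Suc H(4)[of m] by blast
    qed
  qed (use incseqD[OF inc, of 0 n] in auto)
  then have Y_fin: "finite (Y \<inter> \<Union>(V ` H n))" for n
    unfolding Y_def by (intro finite_subset[OF _ H(1)[of n]]) blast
  have "Y \<subseteq> topspace X" using H(2) by (auto simp: Y_def)
  moreover have "\<exists>U. openin X U \<and> x \<in> U \<and> finite (Y \<inter> U)" if "x \<in> topspace X" for x
    using cover[OF that] Y_fin W_open unfolding W_def H_def by blast
  ultimately have "closedin X Y" "subtopology X Y = discrete_topology Y"
    using locally_finite_imp_closed_discrete[OF assms(1)] by blast+
  moreover have "(\<Union>x\<in>Y. V x) = topspace X"
  proof
    show "(\<Union>x\<in>Y. V x) \<subseteq> topspace X"
      using V(1) \<open>Y \<subseteq> topspace X\<close> openin_subset by blast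
    show "topspace X \<subseteq> (\<Union>x\<in>Y. V x)" using cover unfolding Y_def by blast
  qed
  ultimately show "\<exists>Y. closedin X Y \<and> subtopology X Y = discrete_topology Y \<and>
      (\<Union>x\<in>Y. V x) = topspace X" by blast
qed

end
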